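(* Let $X \neq \{0\}$ be a normed vector space over a field $\mathbf{F}$ of characteristic $0$. Let $I = \{1,2,3,\ldots\}$ or $I = \{1,2,\ldots,k\}$ for some positive integer $k$. Let $h \geq 2$ be an integer and let $A = \{a_i : i \in I\}$ be a subset of $X$, with $a_i \neq a_j$ for all $i \neq j$, such that $\Delta_{hA} > 0$. For every set $\varepsilon = \{\varepsilon_i : i \in I\}$ of positive real numbers, there are uncountably many $B_h$-sets $A' = \{a'_i : i \in I\}$ in $X$ that are $\varepsilon$-perturbations of $A$.
   Context: The norm on $X$ is written $|\cdot|$. Sets written $\{x_i : i \in I\}$ are indexed by $I$; for the sets $A$ and $A'$ to which the notions of sumset and $B_h$-set are applied, the elements with distinct indices are distinct. Let $\mathcal{M}(h,I)$ be the set of all families $\{m_i : i \in I\}$ of nonnegative integers indexed by $I$ such that $\sum_{i \in I} m_i = h$. Two such families are equal if they agree at every index. For a subset $A = \{a_i : i \in I\}$ of $X$ with $a_i \neq a_j$ for $i \neq j$: - The $h$-fold sumset is $hA = \{ \sum_{i \in I} m_i a_i : \{m_i : i\in I\} \in \mathcal{M}(h,I) \}$, the set of all sums of $h$ not necessarily distinct elements of $A$. - The set $A$ is a $B_h$-set if every $x \in hA$ has exactly one representation, that is, there is exactly one family $\{m_i : i \in I\} \in \mathcal{M}(h,I)$ with $\sum_{i \in I} m_i a_i = x$. For a subset $B$ of $X$ with more than one element, $\Delta_B = \inf\{ |b - b'| : b, b' \in B,\ b \neq b' \}$. In particular, $\Delta_{hA} = \inf\{|x-x'| : x,x' \in hA,\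 x \neq x'\}$. Given positive real numbers $\varepsilon = \{\varepsilon_i : i \in I\}$, a set $A' = \{a'_i : i \in I\}$ in $X$ is an $\varepsilon$-perturbation of $A = \{a_i : i \in I\}$ if $|a'_i - a_i| < \varepsilon_i$ for all $i \in I$.
   Formalization: The absolute value on F is assumed nontrivial, and X is assumed uncountable when I is finite; the claim fails otherwise, e.g. for X = F = Q with A = {0,1} (only countably many finite subsets), or for a discrete norm over a trivially valued field. *)

theory Defs
  imports
    Complex_Main
    "HOL-Library.Countable_Set"
    "HOL-Library.Extended_Real"
begin

text \<open>
  The type class \<^class>\<open>real_normed_vector\<close> only covers scalars in the reals, so normed vector
  spaces over a field with an absolute value are introduced here. As usual for normed vector
  spaces, the absolute value is not the trivial one: over a trivially valued field the norm can
  be discrete, and then small perturbations do not move any point.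
\<close>

locale absolute_value =
  fixes absv :: "'f::field \<Rightarrow> real"
  assumes absv_nonneg: "0 \<le> absv c"
    and absv_eq_0_iff: "absv c = 0 \<longleftrightarrow> c = 0"
    and absv_mult: "absv (c * d) = absv c * absv d"
    and absv_triangle: "absv (c + d) \<le> absv c + absv d"

locale nontrivial_absolute_value = absolute_value +
  assumes absv_nontrivial: "\<exists>c. c \<noteq> 0 \<and> absv c \<noteq> 1"

locale normed_space_over =
  nontrivial_absolute_value absv + vector_space scale
  for absv :: "'f::field \<Rightarrow> real"
    and scale :: "'f \<Rightarrow> 'x::ab_group_add \<Rightarrow> 'x" +
  fixes nrm :: "'x \<Rightarrow> real"
  assumes nrm_nonneg: "0 \<le> nrm x"
    and nrm_eq_0_iff: "nrm x = 0 \<longleftrightarrow> x = 0"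
    and nrm_triangle: "nrm (x + y) \<le> nrm x + nrm y"
    and nrm_scale: "nrm (scale c x) = absv c * nrm x"

lemma real_normed_space_over:
  "normed_space_over (abs :: real \<Rightarrow> real) scaleR (norm :: 'x::real_normed_vector \<Rightarrow> real)"
proof unfold_locales
  show "\<exists>c::real. c \<noteq> 0 \<and> \<bar>c\<bar> \<noteq> 1"
    by (rule exI[of _ 2]) simp
qed (auto simp: abs_mult norm_triangle_ineq scaleR_add_right scaleR_add_left)

text \<open>
  Values outside the index set are fixed to be 0, so that equality of functions is equality at
  every index. A family of nonnegative integers with a finite sum has finite support, and the
  sums are taken over the support because \<^const>\<open>sum\<close> is 0 on infinite sets.
\<close>

definition mult_families :: "nat \<Rightarrow> 'i set \<Rightarrow> ('i \<Rightarrow> nat) set" where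
  "mult_families h I =
    {m. (\<forall>i. i \<notin> I \<longrightarrow> m i = 0) \<and> finite {i \<in> I. m i \<noteq> 0} \<and> (\<Sum>i | i \<in> I \<and> m i \<noteq> 0. m i) = h}"

definition family_sum ::
  "('f::field \<Rightarrow> 'x::ab_group_add \<Rightarrow> 'x) \<Rightarrow> 'i set \<Rightarrow> ('i \<Rightarrow> 'x) \<Rightarrow> ('i \<Rightarrow> nat) \<Rightarrow> 'x" where
  "family_sum scale I a m = (\<Sum>i | i \<in> I \<and> m i \<noteq> 0. scale (of_nat (m i)) (a i))"

definition h_sumset ::
  "('f::field \<Rightarrow> 'x::ab_group_add \<Rightarrow> 'x) \<Rightarrow> nat \<Rightarrow> 'i set \<Rightarrow> ('i \<Rightarrow> 'x) \<Rightarrow> 'x set" where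
  "h_sumset scale h I a = {family_sum scale I a m | m. m \<in> mult_families h I}"

definition is_Bh_set ::
  "('f::field \<Rightarrow> 'x::ab_group_add \<Rightarrow> 'x) \<Rightarrow> nat \<Rightarrow> 'i set \<Rightarrow> ('i \<Rightarrow> 'x) \<Rightarrow> bool" where
  "is_Bh_set scale h I a \<longleftrightarrow>
    inj_on a I \<and>
    (\<forall>x \<in> h_sumset scale h I a. \<exists>!m. m \<in> mult_families h I \<and> family_sum scale I a m = x)"

text \<open>
  The infimum is taken in \<^typ>\<open>ereal\<close>, so it is \<open>\<infinity>\<close> for a set with at most one element.
\<close>

definition min_gap :: "('x::ab_group_add \<Rightarrow> real) \<Rightarrow> 'x set \<Rightarrow> ereal" where
  "min_gap nrm B = Inf {ereal (nrm (b - b')) | b b'. b \<in> B \<and> b' \<in> B \<and> b \<noteq> b'}"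

definition is_perturbation ::
  "('x::ab_group_add \<Rightarrow> real) \<Rightarrow> 'i set \<Rightarrow> ('i \<Rightarrow> real) \<Rightarrow> ('i \<Rightarrow> 'x) \<Rightarrow> ('i \<Rightarrow> 'x) \<Rightarrow> bool" where
  "is_perturbation nrm I \<epsilon> a a' \<longleftrightarrow> (\<forall>i \<in> I. nrm (a' i - a i) < \<epsilon> i)"

end

theory Submission
  imports Defs "HOL-Library.FuncSet"
begin

text \<open>
  Two facts drive the proof.

  First, failing to be a \<open>B\<^sub>h\<close>-set is a linear coincidence. If two different families give
  the same sum, subtract them and let \<open>n\<close> be the largest index where they differ: this writes
  \<open>a\<^sub>n\<close> as a combination of the earlier points, with rational coefficients taken from a finite
  set. In characteristic 0 the coefficient of \<open>a\<^sub>n\<close> can be divided out, so once the earlier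
  points are chosen, only finitely many values of \<open>a\<^sub>n\<close> are bad (\<open>finite_dependent_points\<close>,
  \<open>Bh_set_if_avoids_dependent_points\<close>). Hence the points can be chosen one after the other from
  any prescribed infinite sets (\<open>exists_Bh_set_in_infinite_sets\<close>). Balls are infinite because
  the absolute value is nontrivial.

  Second, \<open>\<Delta>\<^bsub>hA\<^esub> > 0\<close> separates the points of \<open>A\<close> uniformly (\<open>separated_if_min_gap_pos\<close>).
  Small balls around them are therefore disjoint, and a perturbation that stays in these balls is
  determined by its underlying set: its \<open>i\<close>-th point is its only point in the \<open>i\<close>-th ball.

  Uncountability is then a diagonal argument. Given countably many such sets, attach to each set
  \<open>A\<close> an index \<open>\<kappa> A\<close>, and require that the new perturbation differ from \<open>A\<close> in the point with
  index \<open>\<kappa> A\<close>. If \<open>I\<close> is infinite, \<open>\<kappa>\<close> can be injective and each index excludes at most one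
  further point. If \<open>I\<close> is finite, all sets get the index 1, so countably many points are
  excluded from the first ball, which is uncountable since \<open>X\<close> is.
\<close>

section \<open>Balls in normed spaces over a valued field\<close>

context normed_space_over
begin

lemma absv_1: "absv 1 = 1"
  using absv_mult[of 1 1] absv_eq_0_iff[of 1] by simp

lemma absv_minus_1: "absv (- 1) = 1"
proof -
  have "absv (- 1) * absv (- 1) = 1"
    using absv_mult[of "- 1" "- 1"] absv_1 by simp
  then have "(absv (- 1))\<^sup>2 = 1"
    by (simp add: power2_eq_square)
  with absv_nonneg[of "- 1"] show ?thesis
    by (auto simp: power2_eq_1_iff)
qed

lemma absv_power: "absv (c ^ n) = absv c ^ n"
  by (induction n) (auto simp: absv_1 absv_mult)

lemma nrm_minus_commute: "nrm (x - y) = nrm (y - x)"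
  using nrm_scale[of "- 1" "x - y"] by (simp add: absv_minus_1)

lemma contracting_scalar: obtains c where "c \<noteq> 0" "0 < absv c" "absv c < 1"
proof -
  obtain c where c: "c \<noteq> 0" "absv c \<noteq> 1"
    using absv_nontrivial by blast
  have pos: "absv d > 0" if "d \<noteq> 0" for d
    using that absv_nonneg[of d] absv_eq_0_iff[of d] by linarith
  show ?thesis
  proof (cases "absv c < 1")
    case True
    with c pos that show ?thesis by blast
  next
    case False
    with c have "absv c > 1" by simp
    moreover have "absv c * absv (inverse c) = 1"
      using c absv_mult[of c "inverse c"] absv_1 by simp
    ultimately have "absv (inverse c) < 1"
      using pos[of "inverse c"] c by (metis inverse_less_1_iff inverse_unique)
    with c pos[of "inverse c"] that[of "inverse c"] show ?thesis by simp
  qed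
qed

lemma eventually_small_multiple:
  assumes "0 < absv c" "absv c < 1" "e > 0"
  shows "\<exists>n. nrm (scale (c ^ n) x) < e"
proof -
  have "(\<lambda>n. absv c ^ n * nrm x) \<longlonglongrightarrow> 0 * nrm x"
    using assms by (intro tendsto_mult LIMSEQ_power_zero tendsto_const) auto
  then have "(\<lambda>n. absv c ^ n * nrm x) \<longlonglongrightarrow> 0" by simp
  then have "eventually (\<lambda>n. absv c ^ n * nrm x < e) sequentially"
    using assms(3) by (rule order_tendstoD)
  then show ?thesis
    by (auto simp: nrm_scale absv_power eventually_sequentially)
qed

text \<open>The points \<open>p + c\<^sup>n x\<close> with \<open>0 < |c| < 1\<close> have distinct distances to \<open>p\<close>, tending to 0.\<close>

lemma infinite_ball:
  fixes x :: 'x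
  assumes "x \<noteq> 0" "e > 0"
  shows "infinite {y. nrm (y - p) < e}"
proof -
  obtain c where c: "c \<noteq> 0" "0 < absv c" "absv c < 1"
    by (rule contracting_scalar)
  obtain N where N: "nrm (scale (c ^ N) x) < e"
    using eventually_small_multiple c assms by blast
  have x: "nrm x > 0"
    using assms nrm_nonneg[of x] nrm_eq_0_iff[of x] by linarith
  define f where "f n = p + scale (c ^ (N + n)) x" for n
  have nrm_f: "nrm (f n - p) = absv c ^ (N + n) * nrm x" for n
    by (simp add: f_def nrm_scale absv_power)
  have "inj f"
  proof (rule injI)
    fix m n assume "f m = f n"
    then have "absv c ^ (N + m) = absv c ^ (N + n)"
      using nrm_f[of m] nrm_f[of n] x by simp
    then show "m = n"
      using c power_inject_exp'[of "absv c"] by auto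
  qed
  moreover have "range f \<subseteq> {y. nrm (y - p) < e}"
  proof safe
    fix n
    have "absv c ^ (N + n) * nrm x \<le> absv c ^ N * nrm x"
      using c x by (intro mult_right_mono power_decreasing) auto
    with N show "nrm (f n - p) < e"
      by (simp add: nrm_f) (simp add: nrm_scale absv_power)
  qed
  ultimately show ?thesis
    using range_inj_infinite infinite_super by blast
qed

text \<open>Countably many rescaled copies of a ball around 0 cover the whole space.\<close>

lemma uncountable_ball:
  assumes "uncountable (UNIV :: 'x set)" "e > 0"
  shows "uncountable {y. nrm (y - p) < e}"
proof
  assume count: "countable {y. nrm (y - p) < e}"
  obtain c where c: "c \<noteq> 0" "0 < absv c" "absv c < 1"
    by (rule contracting_scalar)
  have "UNIV \<subseteq> (\<Union>n. (\<lambda>y. scale (inverse (c ^ n)) (y - p)) ` {y. nrm (y - p) < e})"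
  proof
    fix x
    obtain n where "nrm (scale (c ^ n) x) < e"
      using eventually_small_multiple c assms by blast
    moreover have "x = scale (inverse (c ^ n)) ((p + scale (c ^ n) x) - p)"
      using c by simp
    ultimately show "x \<in> (\<Union>n. (\<lambda>y. scale (inverse (c ^ n)) (y - p)) ` {y. nrm (y - p) < e})"
      by (intro UN_I[of n] image_eqI[of _ _ "p + scale (c ^ n) x"]) auto
  qed
  moreover have "countable (\<Union>n. (\<lambda>y. scale (inverse (c ^ n)) (y - p)) ` {y. nrm (y - p) < e})"
    using count by blast
  ultimately show False
    using assms(1) countable_subset by blast
qed

end

section \<open>Choosing the points of a \<open>B\<^sub>h\<close>-set one by one\<close>

text \<open>
  The points \<open>x\<close> with \<open>c x + \<Sum>i<n. d\<^sub>i f\<^sub>i = 0\<close> for integers \<open>c\<close> and \<open>d\<^sub>i\<close> of absolute value at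
  most \<open>h\<close>, solved for \<open>x\<close>. These bounds hold for the differences of two families in
  \<^term>\<open>mult_families h I\<close>. The case \<open>c = 0\<close> only contributes the point 0.
\<close>

definition dependent_points ::
  "('f::field_char_0 \<Rightarrow> 'x::ab_group_add \<Rightarrow> 'x) \<Rightarrow> nat \<Rightarrow> (nat \<Rightarrow> 'x) \<Rightarrow> nat \<Rightarrow> 'x set" where
  "dependent_points scale h f n =
    (\<lambda>(c, d). - scale (inverse (of_int c)) (\<Sum>i<n. scale (of_int (d i)) (f i))) `
      ({- int h..int h} \<times> (PiE {..<n} (\<lambda>_. {- int h..int h})))"

lemma finite_dependent_points: "finite (dependent_points scale h f n)"
  unfolding dependent_points_def by (intro finite_imageI finite_cartesian_product finite_PiE) auto

lemma dependent_points_cong: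
  assumes "\<And>i. i < n \<Longrightarrow> f i = g i"
  shows "dependent_points scale h f n = dependent_points scale h g n"
proof -
  have "(\<Sum>i<n. scale (of_int (d i)) (f i)) = (\<Sum>i<n. scale (of_int (d i)) (g i))" for d
    using assms by (intro sum.cong) auto
  then show ?thesis
    by (simp add: dependent_points_def)
qed

lemma mult_families_le:
  assumes "m \<in> mult_families h I"
  shows "m i \<le> h"
proof (cases "m i = 0")
  case False
  with assms have "i \<in> {i \<in> I. m i \<noteq> 0}" "finite {i \<in> I. m i \<noteq> 0}"
    by (auto simp: mult_families_def)
  then have "m i \<le> (\<Sum>i | i \<in> I \<and> m i \<noteq> 0. m i)"
    by (intro member_le_sum) auto
  with assms show ?thesis
    by (simp add: mult_families_def)
qed simp

lemma (in vector_space) family_sum_eq_sum: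
  assumes "m \<in> mult_families h I" "finite J" "{i \<in> I. m i \<noteq> 0} \<subseteq> J"
  shows "family_sum scale I a m = (\<Sum>i\<in>J. scale (of_nat (m i)) (a i))"
  unfolding family_sum_def
proof (rule sum.mono_neutral_left)
  show "\<forall>i\<in>J - {i \<in> I. m i \<noteq> 0}. scale (of_nat (m i)) (a i) = 0"
  proof
    fix i assume "i \<in> J - {i \<in> I. m i \<noteq> 0}"
    with assms(1) have "m i = 0"
      by (auto simp: mult_families_def)
    then show "scale (of_nat (m i)) (a i) = 0"
      by simp
  qed
qed (use assms in auto)

lemma is_Bh_setI:
  assumes "inj_on a I" "inj_on (family_sum scale I a) (mult_families h I)"
  shows "is_Bh_set scale h I a"
  using assms unfolding is_Bh_set_def h_sumset_def inj_on_def by blast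

text \<open>
  The difference of two families with equal sums is a vanishing integer combination; its last
  nonzero coefficient puts the point it belongs to among the dependent points.
\<close>

lemma Bh_set_if_avoids_dependent_points:
  fixes scale :: "'f::field_char_0 \<Rightarrow> 'x::ab_group_add \<Rightarrow> 'x"
  assumes "vector_space scale" and inj: "inj_on a I"
    and avoid: "\<And>n. n \<in> I \<Longrightarrow> a n \<notin> dependent_points scale h a n"
  shows "is_Bh_set scale h I a"
proof (rule is_Bh_setI[OF inj], rule inj_onI, rule ccontr)
  interpret vector_space scale by fact
  fix m m' assume m: "m \<in> mult_families h I" "m' \<in> mult_families h I"
    and eq: "family_sum scale I a m = family_sum scale I a m'" and "m \<noteq> m'"
  define J where "J = {i \<in> I. m i \<noteq> 0} \<union> {i \<in> I. m' i \<noteq> 0}"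
  define d where "d i = int (m i) - int (m' i)" for i
  have supp: "d i = 0" if "i \<notin> J" for i
    using m that by (auto simp: J_def d_def mult_families_def)
  have fin: "finite J"
    using m by (auto simp: J_def mult_families_def)
  have D: "{i. d i \<noteq> 0} \<subseteq> J" "finite {i. d i \<noteq> 0}"
  proof -
    show "{i. d i \<noteq> 0} \<subseteq> J"
      using supp by auto
    then show "finite {i. d i \<noteq> 0}"
      using fin by (rule finite_subset)
  qed
  have "{i. d i \<noteq> 0} \<noteq> {}"
    using \<open>m \<noteq> m'\<close> by (auto simp: d_def)
  define n where "n = Max {i. d i \<noteq> 0}"
  have n: "d n \<noteq> 0"
    using Max_in[OF D(2) \<open>_ \<noteq> {}\<close>] by (simp add: n_def)
  have above: "i \<le> n" if "d i \<noteq> 0" for i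
    using that D(2) by (auto simp: n_def)
  have bound: "d i \<in> {- int h..int h}" for i
    using mult_families_le[OF m(1), of i] mult_families_le[OF m(2), of i] by (auto simp: d_def)
  have "(\<Sum>i\<in>J. scale (of_nat (m i)) (a i)) = (\<Sum>i\<in>J. scale (of_nat (m' i)) (a i))"
    using eq family_sum_eq_sum[OF m(1) fin] family_sum_eq_sum[OF m(2) fin]
    by (simp add: J_def)
  then have "(\<Sum>i\<in>J. scale (of_int (d i)) (a i)) = 0"
    by (simp add: d_def scale_left_diff_distrib sum_subtractf)
  also have "(\<Sum>i\<in>J. scale (of_int (d i)) (a i)) = (\<Sum>i | d i \<noteq> 0. scale (of_int (d i)) (a i))"
    using fin D by (intro sum.mono_neutral_right) auto
  also have "\<dots> = (\<Sum>i\<le>n. scale (of_int (d i)) (a i))"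
    using above by (intro sum.mono_neutral_left) auto
  also have "\<dots> = (\<Sum>i<n. scale (of_int (d i)) (a i)) + scale (of_int (d n)) (a n)"
    by (simp add: lessThan_Suc_atMost[symmetric])
  finally have "scale (of_int (d n)) (a n) = - (\<Sum>i<n. scale (of_int (d i)) (a i))"
    by (simp add: eq_neg_iff_add_eq_0 add.commute)
  then have "scale (inverse (of_int (d n))) (scale (of_int (d n)) (a n)) =
      - scale (inverse (of_int (d n))) (\<Sum>i<n. scale (of_int (d i)) (a i))"
    by simp
  then have "a n = - scale (inverse (of_int (d n))) (\<Sum>i<n. scale (of_int (d i)) (a i))"
    using n by simp
  also have "(\<Sum>i<n. scale (of_int (d i)) (a i)) =
      (\<Sum>i<n. scale (of_int (restrict d {..<n} i)) (a i))"
    by (intro sum.cong) auto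
  finally have "a n \<in> dependent_points scale h a n"
    unfolding dependent_points_def using bound
    by (intro image_eqI[of _ _ "(d n, restrict d {..<n})"]) auto
  moreover have "n \<in> I"
    using n D by (auto simp: J_def)
  ultimately show False
    using avoid by blast
qed

text \<open>
  At each index only finitely many points are forbidden: the dependent ones and, to keep the
  family injective, those already chosen.
\<close>

lemma exists_Bh_set_in_infinite_sets:
  fixes scale :: "'f::field_char_0 \<Rightarrow> 'x::ab_group_add \<Rightarrow> 'x" and U :: "nat \<Rightarrow> 'x set"
  assumes "vector_space scale"
    and inf: "\<forall>i\<in>I. infinite (U i)"
  shows "\<exists>a. (\<forall>i\<in>I. a i \<in> U i) \<and> is_Bh_set scale h I a"
proof -
  let ?P = "\<lambda>f n x. n \<in> I \<longrightarrow> x \<in> U n - (dependent_points scale h f n \<union> f ` {..<n})"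
  have "\<exists>f. \<forall>n. ?P f n (f n)"
  proof (rule dependent_wellorder_choice)
    fix x :: 'x and f g :: "nat \<Rightarrow> 'x" and n :: nat
    assume eq: "\<And>i. i < n \<Longrightarrow> f i = g i"
    then have "f ` {..<n} = g ` {..<n}"
      by (intro image_cong) auto
    with dependent_points_cong[of n f g scale h, OF eq] show "?P f n x = ?P g n x"
      by simp
  next
    fix n :: nat and f :: "nat \<Rightarrow> 'x"
    have "infinite (U n - (dependent_points scale h f n \<union> f ` {..<n}))" if "n \<in> I"
      using inf that finite_dependent_points by (intro Diff_infinite_finite) auto
    then show "\<exists>x. ?P f n x"
      using infinite_imp_nonempty by blast
  qed
  then obtain a where a: "\<And>n. ?P a n (a n)" by blast
  have "inj_on a I"
  proof (rule linorder_inj_onI')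
    fix i j assume "i \<in> I" "j \<in> I" "i < j"
    then have "a j \<notin> a ` {..<j}" "a i \<in> a ` {..<j}"
      using a[of j] by auto
    then show "a i \<noteq> a j" by metis
  qed
  with a Bh_set_if_avoids_dependent_points[OF assms(1), of a I h] show ?thesis
    by blast
qed

section \<open>Separation of the points of \<open>A\<close>\<close>

text \<open>
  The sums \<open>h a\<^sub>j\<close> and \<open>(h - 1) a\<^sub>j + a\<^sub>i\<close> differ by \<open>a\<^sub>i - a\<^sub>j\<close>, so gaps of \<open>A\<close> are gaps of \<open>hA\<close>.
\<close>

lemma (in normed_space_over) separated_if_min_gap_pos:
  assumes "min_gap nrm (h_sumset scale h I a) > 0" "h \<ge> 1" "inj_on a I"
  obtains \<delta> where "\<delta> > 0" "\<And>i j. \<lbrakk>i \<in> I; j \<in> I; i \<noteq> j\<rbrakk> \<Longrightarrow> \<delta> < nrm (a i - a j)"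
proof -
  obtain \<delta> where \<delta>: "0 < ereal \<delta>" "ereal \<delta> < min_gap nrm (h_sumset scale h I a)"
    using ereal_dense2[OF assms(1)] by auto
  have "\<delta> < nrm (a i - a j)" if ij: "i \<in> I" "j \<in> I" "i \<noteq> j" for i j
  proof -
    define m where "m = (\<lambda>_. 0 :: nat)(j := h)"
    define m' where "m' = (\<lambda>_. 0 :: nat)(j := h - 1, i := 1)"
    have supp: "{l \<in> I. m l \<noteq> 0} \<subseteq> {i, j}" "{l \<in> I. m' l \<noteq> 0} \<subseteq> {i, j}"
      by (auto simp: m_def m'_def)
    have total: "(\<Sum>l | l \<in> I \<and> f l \<noteq> 0. f l) = (\<Sum>l\<in>{i, j}. f l)"
      if "{l \<in> I. f l \<noteq> 0} \<subseteq> {i, j}" for f :: "_ \<Rightarrow> nat"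
      using that ij by (intro sum.mono_neutral_left) auto
    have "m \<in> mult_families h I" "m' \<in> mult_families h I"
      using ij \<open>h \<ge> 1\<close> supp total[OF supp(1)] total[OF supp(2)]
      by (auto simp: mult_families_def m_def m'_def intro: finite_subset[of _ "{i, j}"])
    then have mem: "family_sum scale I a m \<in> h_sumset scale h I a"
        "family_sum scale I a m' \<in> h_sumset scale h I a"
      and sums: "family_sum scale I a m = (\<Sum>l\<in>{i, j}. scale (of_nat (m l)) (a l))"
        "family_sum scale I a m' = (\<Sum>l\<in>{i, j}. scale (of_nat (m' l)) (a l))"
      using supp by (auto simp: h_sumset_def intro!: family_sum_eq_sum)
    have diff: "family_sum scale I a m' - family_sum scale I a m = a i - a j"
      using ij \<open>h \<ge> 1\<close> unfolding sums
      by (simp add: m_def m'_def of_nat_diff scale_left_diff_distrib)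
    moreover have "a i \<noteq> a j"
      using ij assms(3) by (auto dest: inj_onD)
    ultimately have "min_gap nrm (h_sumset scale h I a) \<le> ereal (nrm (a i - a j))"
      unfolding min_gap_def using mem
      by (intro Inf_lower CollectI exI[of _ "family_sum scale I a m'"]
          exI[of _ "family_sum scale I a m"]) auto
    with \<delta>(2) have "ereal \<delta> < ereal (nrm (a i - a j))"
      by (rule less_le_trans)
    then show ?thesis by simp
  qed
  with \<delta>(1) that show ?thesis by simp
qed

section \<open>The diagonal argument\<close>

theorem theorem1:
  fixes absv :: "'f::field_char_0 \<Rightarrow> real"
    and scale :: "'f \<Rightarrow> 'x::ab_group_add \<Rightarrow> 'x"
    and nrm :: "'x \<Rightarrow> real"
    and I :: "nat set"
    and h :: nat
    and a :: "nat \<Rightarrow> 'x"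
    and \<epsilon> :: "nat \<Rightarrow> real"
  assumes "normed_space_over absv scale nrm"
    and "(UNIV :: 'x set) \<noteq> {0}"
    and "finite I \<Longrightarrow> uncountable (UNIV :: 'x set)"
    and "I = {1..} \<or> (\<exists>k\<ge>1. I = {1..k})"
    and "h \<ge> 2"
    and "inj_on a I"
    and "min_gap nrm (h_sumset scale h I a) > 0"
    and "\<And>i. i \<in> I \<Longrightarrow> \<epsilon> i > 0"
  shows "uncountable {A'. \<exists>a'. A' = a' ` I \<and> is_Bh_set scale h I a' \<and> is_perturbation nrm I \<epsilon> a a'}"
proof
  interpret normed_space_over absv scale nrm by fact
  have vs: "vector_space scale" by unfold_locales
  obtain x\<^sub>0 :: 'x where "x\<^sub>0 \<noteq> 0"
    using assms(2) by blast
  obtain \<delta> where \<delta>: "\<delta> > 0" "\<And>i j. \<lbrakk>i \<in> I; j \<in> I; i \<noteq> j\<rbrakk> \<Longrightarrow> \<delta> < nrm (a i - a j)"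
    using separated_if_min_gap_pos[OF assms(7)] assms(5,6) by auto
  \<comment> \<open>Radius at most \<open>\<delta> / 2\<close> makes the balls \<open>B i\<close> disjoint.\<close>
  define \<rho> where "\<rho> i = min (\<epsilon> i) (\<delta> / 2)" for i
  define B where "B i = {y. nrm (y - a i) < \<rho> i}" for i
  have \<rho>_pos: "\<rho> i > 0" if "i \<in> I" for i
    using that assms(8) \<delta>(1) by (simp add: \<rho>_def)
  have disjoint: "i = j" if "i \<in> I" "j \<in> I" "y \<in> B i" "y \<in> B j" for i j y
  proof (rule ccontr)
    assume "i \<noteq> j"
    have "nrm (a i - a j) \<le> nrm (a i - y) + nrm (y - a j)"
      using nrm_triangle[of "a i - y" "y - a j"] by simp
    also have "\<dots> < \<delta>"
      using that by (simp add: B_def \<rho>_def nrm_minus_commute[of "a i" y])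
    finally show False
      using \<delta>(2)[OF that(1,2) \<open>i \<noteq> j\<close>] by simp
  qed
  define C where
    "C = {A'. \<exists>a'. A' = a' ` I \<and> is_Bh_set scale h I a' \<and> is_perturbation nrm I \<rho> a a'}"
  assume "countable {A'. \<exists>a'. A' = a' ` I \<and> is_Bh_set scale h I a' \<and> is_perturbation nrm I \<epsilon> a a'}"
  then have C: "countable C"
    by (rule countable_subset[rotated]) (auto simp: C_def is_perturbation_def \<rho>_def)
  have fin_ball: "finite (A \<inter> B i)" if A: "A \<in> C" and i: "i \<in> I" for A i
  proof -
    obtain a' where a': "A = a' ` I" "\<And>j. j \<in> I \<Longrightarrow> a' j \<in> B j"
      using A by (auto simp: C_def is_perturbation_def B_def)
    then have "A \<inter> B i \<subseteq> {a' i}"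
      using disjoint i by blast
    then show ?thesis
      by (rule finite_subset) simp
  qed
  obtain \<kappa> where \<kappa>: "\<And>A. A \<in> C \<Longrightarrow> \<kappa> A \<in> I"
    and inf: "\<forall>i\<in>I. infinite (B i - (\<Union>A\<in>{A \<in> C. \<kappa> A = i}. A \<inter> B i))"
  proof (cases "finite I")
    case True
    have "uncountable (B i - (\<Union>A\<in>{A \<in> C. 1 = i}. A \<inter> B i))" if i: "i \<in> I" for i
    proof (rule uncountable_minus_countable)
      show "uncountable (B i)"
        unfolding B_def using uncountable_ball assms(3) True \<rho>_pos i by blast
      show "countable (\<Union>A\<in>{A \<in> C. 1 = i}. A \<inter> B i)"
      proof (rule countable_UN)
        show "countable {A \<in> C. 1 = i}"
          by (rule countable_subset[OF _ C]) auto
      qed (use fin_ball i in \<open>auto intro: countable_finite\<close>)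
    qed
    then show ?thesis
      using that[of "\<lambda>_. 1"] assms(4) uncountable_infinite by auto
  next
    case False
    \<comment> \<open>Indices start at 1, the enumeration of \<open>C\<close> at 0.\<close>
    define \<kappa> where "\<kappa> A = Suc (to_nat_on C A)" for A
    have inj: "inj_on \<kappa> C"
      using inj_on_to_nat_on[OF C] by (auto simp: \<kappa>_def inj_on_def)
    have "infinite (B i - (\<Union>A\<in>{A \<in> C. \<kappa> A = i}. A \<inter> B i))" if i: "i \<in> I" for i
    proof (rule Diff_infinite_finite)
      show "infinite (B i)"
        unfolding B_def using infinite_ball \<open>x\<^sub>0 \<noteq> 0\<close> \<rho>_pos i by blast
      have "finite {A \<in> C. \<kappa> A = i}"
        using finite_vimage_IntI[OF _ inj, of "{i}"] by (simp add: vimage_def Int_def conj_commute)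
      then show "finite (\<Union>A\<in>{A \<in> C. \<kappa> A = i}. A \<inter> B i)"
        using fin_ball i by (intro finite_UN_I) auto
    qed
    moreover have "\<kappa> A \<in> I" for A
      using False assms(4) by (auto simp: \<kappa>_def)
    ultimately show ?thesis
      using that by blast
  qed
  obtain a' where a': "\<forall>i\<in>I. a' i \<in> B i - (\<Union>A\<in>{A \<in> C. \<kappa> A = i}. A \<inter> B i)"
    and Bh: "is_Bh_set scale h I a'"
    using exists_Bh_set_in_infinite_sets[OF vs inf, of h] by (elim exE conjE)
  have "is_perturbation nrm I \<rho> a a'"
    using a' by (auto simp: is_perturbation_def B_def)
  with Bh have new: "a' ` I \<in> C"
    by (auto simp: C_def)
  then have "\<kappa> (a' ` I) \<in> I"
    by (rule \<kappa>)
  with bspec[OF a', of "\<kappa> (a' ` I)"] new show False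
    by auto
qed

end
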